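(* Let $h:\omega\to\omega\setminus\{0\}$ be strictly increasing, and let $T_h$ be the first-order theory in the language $L=\{E_n:n\in\omega\}$ (each $E_n$ a binary relation symbol) asserting that each $E_n$ is an equivalence relation with exactly $h(n)$ classes, and that for every nonempty finite $F\subseteq\omega$ the relation $E_F(x,y):=\bigwedge_{n\in F}E_n(x,y)$ is an equivalence relation with exactly $\prod_{n\in F}h(n)$ classes. Then $T_h$ is Borel complete.
   Context: For a countable first-order theory $T$, ${\rm Mod}(T)$ denotes the (standard Borel) space of models of $T$ whose universe is exactly $\omega$. For countable theories $T,S$ (possibly in different countable languages), $T$ is Borel reducible to $S$ if there is a Borel function $f:{\rm Mod}(T)\to{\rm Mod}(S)$ such that for all $M,N\in{\rm Mod}(T)$, $M\cong N$ iff $f(M)\cong f(N)$. A theory (or Borel class of countable structures invariant under permutations of $\omega$) is Borel complete if it is maximal under this quasi-order among all such classes (Friedman–Stanley); equivalently, e.g., the class of countable graphs is Borel reducible to it. *)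

theory Defs
  imports "HOL-Analysis.Analysis"
begin

section \<open>Countable first-order languages and their formulas\<close>

text \<open>
  The symbols of a language are natural numbers; up to renaming of symbols this covers every
  countable language. Arity 0 is allowed (propositional symbols, constants).
\<close>

record lang =
  rels :: "nat set"
  rel_ar :: "nat \<Rightarrow> nat"
  funs :: "nat set"
  fun_ar :: "nat \<Rightarrow> nat"

datatype tm = Var nat | Fn nat "tm list"

datatype fm =
    Tru
  | Eq tm tm
  | Rel nat "tm list"
  | Neg fm
  | Conj fm fm
  | All nat fm

abbreviation Disj :: "fm \<Rightarrow> fm \<Rightarrow> fm" where
  "Disj p q \<equiv> Neg (Conj (Neg p) (Neg q))"

abbreviation Imp :: "fm \<Rightarrow> fm \<Rightarrow> fm" where
  "Imp p q \<equiv> Neg (Conj p (Neg q))"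

abbreviation Ex :: "nat \<Rightarrow> fm \<Rightarrow> fm" where
  "Ex x p \<equiv> Neg (All x (Neg p))"

definition Conjs :: "fm list \<Rightarrow> fm" where
  "Conjs ps = foldr Conj ps Tru"

definition Disjs :: "fm list \<Rightarrow> fm" where
  "Disjs ps = foldr (\<lambda>p q. Disj p q) ps (Neg Tru)"

definition Exs :: "nat list \<Rightarrow> fm \<Rightarrow> fm" where
  "Exs xs p = foldr (\<lambda>x q. Ex x q) xs p"

primrec tm_in :: "lang \<Rightarrow> tm \<Rightarrow> bool" where
  "tm_in L (Var x) \<longleftrightarrow> True"
| "tm_in L (Fn f ts) \<longleftrightarrow> f \<in> funs L \<and> length ts = fun_ar L f \<and> list_all (tm_in L) ts"

primrec fm_in :: "lang \<Rightarrow> fm \<Rightarrow> bool" where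
  "fm_in L Tru \<longleftrightarrow> True"
| "fm_in L (Eq s t) \<longleftrightarrow> tm_in L s \<and> tm_in L t"
| "fm_in L (Rel r ts) \<longleftrightarrow> r \<in> rels L \<and> length ts = rel_ar L r \<and> list_all (tm_in L) ts"
| "fm_in L (Neg p) \<longleftrightarrow> fm_in L p"
| "fm_in L (Conj p q) \<longleftrightarrow> fm_in L p \<and> fm_in L q"
| "fm_in L (All x p) \<longleftrightarrow> fm_in L p"

primrec fv_tm :: "tm \<Rightarrow> nat set" where
  "fv_tm (Var x) = {x}"
| "fv_tm (Fn f ts) = \<Union> (set (map fv_tm ts))"

primrec fv :: "fm \<Rightarrow> nat set" where
  "fv Tru = {}"
| "fv (Eq s t) = fv_tm s \<union> fv_tm t"
| "fv (Rel r ts) = \<Union> (fv_tm ` set ts)"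
| "fv (Neg p) = fv p"
| "fv (Conj p q) = fv p \<union> fv q"
| "fv (All x p) = fv p - {x}"

definition is_theory :: "lang \<Rightarrow> fm set \<Rightarrow> bool" where
  "is_theory L T \<longleftrightarrow> (\<forall>p\<in>T. fm_in L p \<and> fv p = {})"


section \<open>The space of structures with universe \<open>\<omega>\<close>\<close>

text \<open>
  A structure with universe \<^typ>\<open>nat\<close> assigns a truth value to every relational atom \<open>(R, xs)\<close>
  and a value to every functional atom \<open>(f, xs)\<close>, where \<open>xs\<close> is a tuple of the right length. So
  the space of structures is the product of countably many countable discrete spaces; its Borel
  sigma-algebra is the product sigma-algebra. Outside the atoms of the language the components
  of a structure are \<open>undefined\<close> (this is how the library represents dependent products), so
  that different points of the space are different structures.
\<close>

type_synonym struct = "(nat \<times> nat list \<Rightarrow> bool) \<times> (nat \<times> nat list \<Rightarrow> nat)"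

definition rel_atoms :: "lang \<Rightarrow> (nat \<times> nat list) set" where
  "rel_atoms L = {(r, xs). r \<in> rels L \<and> length xs = rel_ar L r}"

definition fun_atoms :: "lang \<Rightarrow> (nat \<times> nat list) set" where
  "fun_atoms L = {(f, xs). f \<in> funs L \<and> length xs = fun_ar L f}"

definition Str :: "lang \<Rightarrow> struct measure" where
  "Str L = (\<Pi>\<^sub>M a\<in>rel_atoms L. count_space UNIV) \<Otimes>\<^sub>M (\<Pi>\<^sub>M a\<in>fun_atoms L. count_space UNIV)"

primrec val :: "struct \<Rightarrow> (nat \<Rightarrow> nat) \<Rightarrow> tm \<Rightarrow> nat" where
  "val M e (Var x) = e x"
| "val M e (Fn f ts) = snd M (f, map (val M e) ts)"

primrec sat :: "struct \<Rightarrow> (nat \<Rightarrow> nat) \<Rightarrow> fm \<Rightarrow> bool" where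
  "sat M e Tru \<longleftrightarrow> True"
| "sat M e (Eq s t) \<longleftrightarrow> val M e s = val M e t"
| "sat M e (Rel r ts) \<longleftrightarrow> fst M (r, map (val M e) ts)"
| "sat M e (Neg p) \<longleftrightarrow> \<not> sat M e p"
| "sat M e (Conj p q) \<longleftrightarrow> sat M e p \<and> sat M e q"
| "sat M e (All x p) \<longleftrightarrow> (\<forall>a. sat M (e(x := a)) p)"

definition Mod :: "lang \<Rightarrow> fm set \<Rightarrow> struct set" where
  "Mod L T = {M \<in> space (Str L). \<forall>p\<in>T. \<forall>e. sat M e p}"

definition iso_via :: "lang \<Rightarrow> (nat \<Rightarrow> nat) \<Rightarrow> struct \<Rightarrow> struct \<Rightarrow> bool" where
  "iso_via L g M N \<longleftrightarrow> bij g \<and>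
     (\<forall>(r, xs)\<in>rel_atoms L. fst M (r, xs) \<longleftrightarrow> fst N (r, map g xs)) \<and>
     (\<forall>(f, xs)\<in>fun_atoms L. g (snd M (f, xs)) = snd N (f, map g xs))"

definition isomorphic :: "lang \<Rightarrow> struct \<Rightarrow> struct \<Rightarrow> bool" where
  "isomorphic L M N \<longleftrightarrow> (\<exists>g. iso_via L g M N)"


section \<open>Borel reducibility and Borel completeness\<close>

definition invariant_borel_class :: "lang \<Rightarrow> struct set \<Rightarrow> bool" where
  "invariant_borel_class L K \<longleftrightarrow>
     K \<in> sets (Str L) \<and> (\<forall>M\<in>K. \<forall>N\<in>space (Str L). isomorphic L M N \<longrightarrow> N \<in> K)"

definition borel_reducible :: "lang \<Rightarrow> struct set \<Rightarrow> lang \<Rightarrow> struct set \<Rightarrow> bool" where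
  "borel_reducible L K L' K' \<longleftrightarrow>
     (\<exists>f \<in> restrict_space (Str L) K \<rightarrow>\<^sub>M restrict_space (Str L') K'.
        \<forall>M\<in>K. \<forall>N\<in>K. isomorphic L M N \<longleftrightarrow> isomorphic L' (f M) (f N))"

text \<open>
  Maximal in the sense of Friedman and Stanley: a largest element of the quasi-order of Borel
  reducibility on the invariant Borel classes of structures, over all countable languages.
\<close>

definition borel_complete :: "lang \<Rightarrow> struct set \<Rightarrow> bool" where
  "borel_complete L K \<longleftrightarrow> invariant_borel_class L K \<and>
     (\<forall>L' K'. invariant_borel_class L' K' \<longrightarrow> borel_reducible L' K' L K)"

definition borel_complete_theory :: "lang \<Rightarrow> fm set \<Rightarrow> bool" where
  "borel_complete_theory L T \<longleftrightarrow> is_theory L T \<and> borel_complete L (Mod L T)"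


section \<open>Cross-cutting equivalence relations\<close>

definition L_E :: lang where
  "L_E = \<lparr>rels = UNIV, rel_ar = (\<lambda>_. 2), funs = {}, fun_ar = (\<lambda>_. 0)\<rparr>"

definition E :: "nat \<Rightarrow> nat \<Rightarrow> nat \<Rightarrow> fm" where
  "E n x y = Rel n [Var x, Var y]"

definition E_conj :: "nat set \<Rightarrow> nat \<Rightarrow> nat \<Rightarrow> fm" where
  "E_conj F x y = Conjs (map (\<lambda>n. E n x y) (sorted_list_of_set F))"

text \<open>
  In the following axioms \<open>\<phi> x y\<close> is a quantifier-free formula in the variables \<open>x\<close>, \<open>y\<close>; the
  last axiom says that there are \<open>k\<close> pairwise inequivalent elements, and that every element is
  equivalent to one of them.
\<close>

definition equivalence_axioms :: "(nat \<Rightarrow> nat \<Rightarrow> fm) \<Rightarrow> fm set" where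
  "equivalence_axioms \<phi> =
     {All 0 (\<phi> 0 0),
      All 0 (All 1 (Imp (\<phi> 0 1) (\<phi> 1 0))),
      All 0 (All 1 (All 2 (Imp (Conj (\<phi> 0 1) (\<phi> 1 2)) (\<phi> 0 2))))}"

definition exactly_classes :: "(nat \<Rightarrow> nat \<Rightarrow> fm) \<Rightarrow> nat \<Rightarrow> fm" where
  "exactly_classes \<phi> k =
     Exs [0..<k]
       (Conj (Conjs [Neg (\<phi> i j). j \<leftarrow> [0..<k], i \<leftarrow> [0..<j]])
             (All k (Disjs [\<phi> i k. i \<leftarrow> [0..<k]])))"

definition T_h :: "(nat \<Rightarrow> nat) \<Rightarrow> fm set" where
  "T_h h =
     (\<Union>n. equivalence_axioms (E n) \<union> {exactly_classes (E n) (h n)}) \<union>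
     (\<Union>F\<in>{F. finite F \<and> F \<noteq> {}}.
        equivalence_axioms (E_conj F) \<union> {exactly_classes (E_conj F) (\<Prod>n\<in>F. h n)})"

lemma sat_Conjs [simp]: "sat M e (Conjs ps) \<longleftrightarrow> (\<forall>p\<in>set ps. sat M e p)"
  by (induction ps) (auto simp: Conjs_def)

lemma sat_Disjs [simp]: "sat M e (Disjs ps) \<longleftrightarrow> (\<exists>p\<in>set ps. sat M e p)"
  by (induction ps) (auto simp: Disjs_def)

lemma sat_Exs:
  "sat M e (Exs [0..<k] p) \<longleftrightarrow> (\<exists>a. sat M (\<lambda>x. if x < k then a x else e x) p)"
proof (induction k arbitrary: p)
  case 0
  show ?case by (simp add: Exs_def)
next
  case (Suc k)
  have "sat M e (Exs [0..<Suc k] p) \<longleftrightarrow> sat M e (Exs [0..<k] (Ex k p))"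
    by (simp add: Exs_def)
  also have "\<dots> \<longleftrightarrow> (\<exists>a b. sat M ((\<lambda>x. if x < k then a x else e x)(k := b)) p)"
    by (simp add: Suc.IH)
  also have "\<dots> \<longleftrightarrow> (\<exists>a. sat M (\<lambda>x. if x < Suc k then a x else e x) p)"
  proof
    assume "\<exists>a b. sat M ((\<lambda>x. if x < k then a x else e x)(k := b)) p"
    then obtain a b where *: "sat M ((\<lambda>x. if x < k then a x else e x)(k := b)) p" by blast
    have "(\<lambda>x. if x < Suc k then (a(k := b)) x else e x) = (\<lambda>x. if x < k then a x else e x)(k := b)"
      by (auto simp: fun_eq_iff)
    with * show "\<exists>a. sat M (\<lambda>x. if x < Suc k then a x else e x) p" by metis
  next
    assume "\<exists>a. sat M (\<lambda>x. if x < Suc k then a x else e x) p"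
    then obtain a where *: "sat M (\<lambda>x. if x < Suc k then a x else e x) p" by blast
    have "(\<lambda>x. if x < Suc k then a x else e x) = (\<lambda>x. if x < k then a x else e x)(k := a k)"
      by (auto simp: fun_eq_iff)
    with * show "\<exists>a b. sat M ((\<lambda>x. if x < k then a x else e x)(k := b)) p" by metis
  qed
  finally show ?case .
qed

lemma sat_E [simp]: "sat M e (E n x y) \<longleftrightarrow> fst M (n, [e x, e y])"
  by (simp add: E_def)

lemma sat_E_conj [simp]:
  "finite F \<Longrightarrow> sat M e (E_conj F x y) \<longleftrightarrow> (\<forall>n\<in>F. fst M (n, [e x, e y]))"
  by (simp add: E_conj_def)

lemma card_quotient_eq_iff:
  assumes eq: "equiv UNIV r" and k: "k > 0"
  shows "card (UNIV // r) = k \<longleftrightarrow>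
    (\<exists>a. (\<forall>j<k. \<forall>i<j. (a i, a j) \<notin> r) \<and> (\<forall>y. \<exists>i<k. (a i, y) \<in> r))"
proof
  assume c: "card (UNIV // r) = k"
  then have "finite (UNIV // r)" using k card_ge_0_finite by blast
  then obtain b where b: "bij_betw b {..<k} (UNIV // r)"
    using c by (metis ex_bij_betw_nat_finite atLeast0LessThan)
  define a where "a i = (SOME x. x \<in> b i)" for i
  have bi: "b i \<in> UNIV // r" if "i < k" for i
    using b that by (auto simp: bij_betw_def)
  have a: "r `` {a i} = b i" if "i < k" for i
  proof -
    have "b i \<noteq> {}" using bi[OF that] eq in_quotient_imp_non_empty by blast
    then have "a i \<in> b i" unfolding a_def by (simp add: some_in_eq)
    then show ?thesis using bi[OF that] eq
      by (metis Image_singleton_iff equiv_class_eq_iff quotientE)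
  qed
  have "(a i, a j) \<notin> r" if "i < j" "j < k" for i j
  proof
    assume "(a i, a j) \<in> r"
    then have "b i = b j" using a that eq equiv_class_eq by (metis less_trans)
    moreover have "inj_on b {..<k}" using b by (simp add: bij_betw_def)
    ultimately have "i = j" using that by (auto dest: inj_onD)
    then show False using that by simp
  qed
  moreover have "\<exists>i<k. (a i, y) \<in> r" for y
  proof -
    have "r `` {y} \<in> UNIV // r" by (simp add: quotientI)
    then obtain i where i: "i < k" "b i = r `` {y}"
      using b unfolding bij_betw_def by (metis imageE lessThan_iff)
    then have "r `` {a i} = r `` {y}" using a by simp
    then show ?thesis using i eq by (metis eq_equiv_class_iff UNIV_I)
  qed
  ultimately show "\<exists>a. (\<forall>j<k. \<forall>i<j. (a i, a j) \<notin> r) \<and> (\<forall>y. \<exists>i<k. (a i, y) \<in> r)"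
    by blast
next
  assume "\<exists>a. (\<forall>j<k. \<forall>i<j. (a i, a j) \<notin> r) \<and> (\<forall>y. \<exists>i<k. (a i, y) \<in> r)"
  then obtain a where a: "\<And>i j. i < j \<Longrightarrow> j < k \<Longrightarrow> (a i, a j) \<notin> r"
    and s: "\<And>y. \<exists>i<k. (a i, y) \<in> r" by blast
  have "inj_on (\<lambda>i. r `` {a i}) {..<k}"
  proof (rule linorder_inj_onI)
    fix i j assume "i < j" "i \<in> {..<k}" "j \<in> {..<k}"
    then show "r `` {a i} \<noteq> r `` {a j}"
      using a eq by (metis UNIV_I eq_equiv_class_iff lessThan_iff)
  qed auto
  moreover have "(\<lambda>i. r `` {a i}) ` {..<k} = UNIV // r"
  proof
    show "(\<lambda>i. r `` {a i}) ` {..<k} \<subseteq> UNIV // r" by (auto simp: quotientI)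
    show "UNIV // r \<subseteq> (\<lambda>i. r `` {a i}) ` {..<k}"
    proof
      fix X assume "X \<in> UNIV // r"
      then obtain y where y: "X = r `` {y}" by (auto elim: quotientE)
      obtain i where i: "i < k" "(a i, y) \<in> r" using s by blast
      have "X = r `` {a i}" using equiv_class_eq[OF eq i(2)] y by simp
      then show "X \<in> (\<lambda>i. r `` {a i}) ` {..<k}" using i(1) by blast
    qed
  qed
  ultimately show "card (UNIV // r) = k" by (metis card_image card_lessThan)
qed

lemma sat_equivalence_classes:
  assumes \<phi>: "\<And>e x y. sat M e (\<phi> x y) \<longleftrightarrow> R (e x) (e y)" and k: "k > 0"
  shows "(\<forall>p\<in>equivalence_axioms \<phi> \<union> {exactly_classes \<phi> k}. \<forall>e. sat M e p) \<longleftrightarrow>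
    equiv UNIV {(x, y). R x y} \<and> card (UNIV // {(x, y). R x y}) = k"
proof -
  let ?r = "{(x, y). R x y}"
  have "(\<forall>p\<in>equivalence_axioms \<phi>. \<forall>e. sat M e p) \<longleftrightarrow>
      (\<forall>x. R x x) \<and> (\<forall>x y. R x y \<longrightarrow> R y x) \<and> (\<forall>x y z. R x y \<longrightarrow> R y z \<longrightarrow> R x z)"
    by (simp add: equivalence_axioms_def \<phi>) blast
  also have "\<dots> \<longleftrightarrow> equiv UNIV ?r"
    by (simp add: equiv_def refl_on_def sym_def trans_def)
  finally have "(\<forall>p\<in>equivalence_axioms \<phi>. \<forall>e. sat M e p) \<longleftrightarrow> equiv UNIV ?r" .
  moreover have "(\<forall>e. sat M e (exactly_classes \<phi> k)) \<longleftrightarrow> card (UNIV // ?r) = k"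
    if "equiv UNIV ?r"
    unfolding card_quotient_eq_iff[OF that k]
    by (simp add: exactly_classes_def sat_Exs \<phi>) (simp add: Ball_def Bex_def)
  ultimately show ?thesis by blast
qed

text \<open>\<open>T_h h\<close> is a set of sentences and has the intended models.\<close>

lemma Mod_T_h:
  assumes "\<And>n. h n \<noteq> 0"
  shows "Mod L_E (T_h h) = {M \<in> space (Str L_E).
    (\<forall>n. let r = {(x, y). fst M (n, [x, y])} in equiv UNIV r \<and> card (UNIV // r) = h n) \<and>
    (\<forall>F. finite F \<and> F \<noteq> {} \<longrightarrow>
       (let r = {(x, y). \<forall>n\<in>F. fst M (n, [x, y])}
        in equiv UNIV r \<and> card (UNIV // r) = (\<Prod>n\<in>F. h n)))}"
proof -
  have 1: "(\<forall>p\<in>equivalence_axioms (E n) \<union> {exactly_classes (E n) (h n)}. \<forall>e. sat M e p) \<longleftrightarrow>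
     (let r = {(x, y). fst M (n, [x, y])} in equiv UNIV r \<and> card (UNIV // r) = h n)" for n M
    unfolding Let_def using assms by (intro sat_equivalence_classes) auto
  have 2: "(\<forall>p\<in>equivalence_axioms (E_conj F) \<union> {exactly_classes (E_conj F) (\<Prod>n\<in>F. h n)}. \<forall>e. sat M e p) \<longleftrightarrow>
     (let r = {(x, y). \<forall>n\<in>F. fst M (n, [x, y])}
      in equiv UNIV r \<and> card (UNIV // r) = (\<Prod>n\<in>F. h n))" if "finite F" for F M
    unfolding Let_def using assms that by (intro sat_equivalence_classes) (auto intro!: prod_pos)
  have ball_iff: "(\<And>F. A F \<Longrightarrow> B F \<longleftrightarrow> C F) \<Longrightarrow> (\<forall>F\<in>{F. A F}. B F) \<longleftrightarrow> (\<forall>F. A F \<longrightarrow> C F)"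
    for A B C :: "nat set \<Rightarrow> bool"
    by blast
  show ?thesis
    unfolding Mod_def T_h_def ball_Un[of "\<Union>n. _ n"] ball_UN 1
    by (intro Collect_cong conj_cong refl ball_iff 2) simp_all
qed

lemma fm_in_fv_Conjs:
  "fm_in L (Conjs ps) \<longleftrightarrow> (\<forall>p\<in>set ps. fm_in L p)" "fv (Conjs ps) = (\<Union>p\<in>set ps. fv p)"
  by (induction ps) (auto simp: Conjs_def)

lemma fm_in_fv_Disjs:
  "fm_in L (Disjs ps) \<longleftrightarrow> (\<forall>p\<in>set ps. fm_in L p)" "fv (Disjs ps) = (\<Union>p\<in>set ps. fv p)"
  by (induction ps) (auto simp: Disjs_def)

lemma fm_in_fv_Exs: "fm_in L (Exs xs p) \<longleftrightarrow> fm_in L p" "fv (Exs xs p) = fv p - set xs"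
  by (induction xs) (auto simp: Exs_def)

lemma is_theory_equivalence_classes:
  assumes "\<And>x y. fm_in L (\<phi> x y)" "\<And>x y. fv (\<phi> x y) \<subseteq> {x, y}"
  shows "is_theory L (equivalence_axioms \<phi> \<union> {exactly_classes \<phi> k})"
proof -
  have *: "z \<in> fv (\<phi> x y) \<Longrightarrow> z = x \<or> z = y" for x y z using assms(2) by blast
  have "is_theory L (equivalence_axioms \<phi>)"
    using assms(1) by (auto simp: is_theory_def equivalence_axioms_def dest: *)
  moreover have "fv (exactly_classes \<phi> k) = {}"
    by (auto simp: exactly_classes_def fm_in_fv_Exs fm_in_fv_Conjs fm_in_fv_Disjs dest!: *)
  moreover have "fm_in L (exactly_classes \<phi> k)"
    using assms(1) by (auto simp: exactly_classes_def fm_in_fv_Exs fm_in_fv_Conjs fm_in_fv_Disjs)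
  ultimately show ?thesis unfolding is_theory_def by blast
qed

lemma is_theory_T_h: "is_theory L_E (T_h h)"
proof -
  have "is_theory L_E (equivalence_axioms (E n) \<union> {exactly_classes (E n) k})" for n k
    by (rule is_theory_equivalence_classes) (auto simp: E_def L_E_def)
  moreover have "is_theory L_E (equivalence_axioms (E_conj F) \<union> {exactly_classes (E_conj F) k})" for F k
    by (rule is_theory_equivalence_classes) (auto simp: E_conj_def fm_in_fv_Conjs E_def L_E_def)
  ultimately show ?thesis
    unfolding T_h_def is_theory_def by blast
qed

end

theory Submission
  imports Defs
begin

text \<open>
  A model of \<open>T_h h\<close> is a family of points of \<open>\<Prod>n. {..<h n}\<close>, dense in the product topology, where
  \<open>E_n\<close> is equality of the \<open>n\<close>-th coordinates. A bounded sequence \<open>u\<close> of naturals is represented by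
  the point whose \<open>n\<close>-th coordinate is \<open>u (slot n)\<close>, where \<open>slot\<close> takes every value infinitely often;
  modulo finite changes this makes sense because \<open>h\<close> is unbounded. Let a model consist of all
  finite modifications of the points of countably many sequences. Every permutation \<open>\<tau>\<close> of \<open>\<nat>\<close> is
  approximated by permutations of the sets \<open>{..<h n}\<close>, hence maps such a model to the model of the
  sequences \<open>\<tau> \<circ> u\<close>. Conversely, an isomorphism respects eventual equality of points, hence acts
  on the sequences; its action on the constant ones defines \<open>\<tau>\<close>, and comparing a point with the points
  of constant sequences shows that it maps \<open>u\<close> to \<open>\<tau> \<circ> u\<close>. Constant sequences are recognized by
  the number of copies of their points, and odd numbers serve as the elements of the structure to be
  coded, while even numbers are labels fixed by every isomorphism.
\<close>

section \<open>Classes of models are invariant Borel classes\<close>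

lemma val_cong: "(\<And>x. x \<in> fv_tm t \<Longrightarrow> e x = e' x) \<Longrightarrow> val M e t = val M e' t"
proof (induction t)
  case (Fn f ts)
  then have "map (val M e) ts = map (val M e') ts" by auto
  then show ?case by (simp only: val.simps)
qed simp

lemma sat_cong: "(\<And>x. x \<in> fv p \<Longrightarrow> e x = e' x) \<Longrightarrow> sat M e p = sat M e' p"
proof (induction p arbitrary: e e')
  case (Eq s t)
  then show ?case using val_cong[of s e e'] val_cong[of t e e'] by simp
next
  case (Rel r ts)
  have "map (val M e) ts = map (val M e') ts"
    by (intro map_cong refl val_cong) (use Rel in auto)
  then show ?case by (simp only: sat.simps)
next
  case (Conj p q)
  have "sat M e p = sat M e' p" by (rule Conj.IH(1)) (simp add: Conj.prems)
  moreover have "sat M e q = sat M e' q" by (rule Conj.IH(2)) (simp add: Conj.prems)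
  ultimately show ?case by simp
next
  case (All x p)
  have "sat M (e(x := a)) p = sat M (e'(x := a)) p" for a
    by (rule All.IH) (simp only: fun_upd_apply, simp add: All.prems)
  then show ?case by simp
next
  case (Neg p)
  have "sat M e p = sat M e' p" by (rule Neg.IH) (simp add: Neg.prems)
  then show ?case by simp
qed simp

lemma iso_viaD:
  assumes "iso_via L g M N"
  shows "bij g"
    and "(r, xs) \<in> rel_atoms L \<Longrightarrow> fst M (r, xs) \<longleftrightarrow> fst N (r, map g xs)"
    and "(f, xs) \<in> fun_atoms L \<Longrightarrow> g (snd M (f, xs)) = snd N (f, map g xs)"
  using assms by (auto simp: iso_via_def)

lemma val_iso:
  assumes g: "iso_via L g M N"
  shows "tm_in L t \<Longrightarrow> g (val M e t) = val N (\<lambda>y. g (e y)) t"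
proof (induction t)
  case (Fn f ts)
  have *: "map g (map (val M e) ts) = map (val N (\<lambda>y. g (e y))) ts"
    by (use Fn in \<open>simp add: list_all_iff\<close>)
  have "(f, map (val M e) ts) \<in> fun_atoms L"
    using Fn.prems by (simp add: fun_atoms_def)
  from iso_viaD(3)[OF g this] show ?case by (simp only: val.simps *)
qed simp

lemma sat_iso:
  assumes g: "iso_via L g M N"
  shows "fm_in L p \<Longrightarrow> sat M e p \<longleftrightarrow> sat N (\<lambda>y. g (e y)) p"
proof (induction p arbitrary: e)
  case (Eq s t)
  then show ?case
    using bij_is_inj[OF iso_viaD(1)[OF g]] by (simp add: inj_eq flip: val_iso[OF g])
next
  case (Rel r ts)
  have *: "map g (map (val M e) ts) = map (val N (\<lambda>y. g (e y))) ts"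
    by (use Rel in \<open>simp add: list_all_iff val_iso[OF g]\<close>)
  have "(r, map (val M e) ts) \<in> rel_atoms L"
    using Rel.prems by (simp add: rel_atoms_def)
  from iso_viaD(2)[OF g this] show ?case by (simp only: sat.simps *)
next
  case (All x p)
  have *: "(\<lambda>y. g (e y))(x := g a) = (\<lambda>y. g ((e(x := a)) y))" for a by auto
  have "sat M e (All x p) \<longleftrightarrow> (\<forall>a. sat N ((\<lambda>y. g (e y))(x := g a)) p)"
    using All by (simp only: sat.simps fm_in.simps *)
  also have "\<dots> \<longleftrightarrow> sat N (\<lambda>y. g (e y)) (All x p)"
    using bij_is_surj[OF iso_viaD(1)[OF g]] unfolding sat.simps by (metis surjD)
  finally show ?case .
qed simp_all

section \<open>Borel measurability of satisfaction\<close>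

lemma measurable_fst_Str: "(\<lambda>M. fst M a) \<in> Str L \<rightarrow>\<^sub>M count_space UNIV"
proof (cases "a \<in> rel_atoms L")
  case True
  then have "(\<lambda>F. F a) \<in> (\<Pi>\<^sub>M a\<in>rel_atoms L. count_space UNIV) \<rightarrow>\<^sub>M count_space UNIV"
    by (rule measurable_component_singleton)
  then show ?thesis
    unfolding Str_def by (rule measurable_compose[OF measurable_fst])
next
  case False
  \<comment> \<open>Off the atoms of the language the component is constant on the space, so no side
    condition on \<open>a\<close> is needed.\<close>
  then have "fst M a = undefined" if "M \<in> space (Str L)" for M
    using that by (auto simp: Str_def space_pair_measure space_PiM)
  then show ?thesis by (rule measurable_cong[THEN iffD2]) simp_all
qed

lemma measurable_snd_Str: "(\<lambda>M. snd M a) \<in> Str L \<rightarrow>\<^sub>M count_space UNIV"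
proof (cases "a \<in> fun_atoms L")
  case True
  then have "(\<lambda>F. F a) \<in> (\<Pi>\<^sub>M a\<in>fun_atoms L. count_space UNIV) \<rightarrow>\<^sub>M count_space UNIV"
    by (rule measurable_component_singleton)
  then show ?thesis
    unfolding Str_def by (rule measurable_compose[OF measurable_snd])
next
  case False
  then have "snd M a = undefined" if "M \<in> space (Str L)" for M
    using that by (auto simp: Str_def space_pair_measure space_PiM)
  then show ?thesis by (rule measurable_cong[THEN iffD2]) simp_all
qed

lemma measurable_map_list:
  fixes f :: "'b \<Rightarrow> 'a \<Rightarrow> 'c :: countable"
  assumes "\<And>x. x \<in> set xs \<Longrightarrow> f x \<in> M \<rightarrow>\<^sub>M count_space UNIV"
  shows "(\<lambda>w. map (\<lambda>x. f x w) xs) \<in> M \<rightarrow>\<^sub>M count_space UNIV"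
  using assms
proof (induction xs)
  case (Cons x xs)
  have "(\<lambda>w. map (\<lambda>x. f x w) xs) \<in> M \<rightarrow>\<^sub>M count_space UNIV"
    by (rule Cons.IH) (simp add: Cons.prems)
  then have "(\<lambda>w. i # map (\<lambda>x. f x w) xs) \<in> M \<rightarrow>\<^sub>M count_space UNIV" for i
    by (rule measurable_compose) simp
  moreover have "f x \<in> M \<rightarrow>\<^sub>M count_space UNIV" by (simp add: Cons.prems)
  ultimately show ?case
    unfolding list.map
    by (rule measurable_compose_countable[of "\<lambda>i w. i # map (\<lambda>x. f x w) xs" M _ "f x"])
qed simp

text \<open>The argument list at which \<open>snd M\<close> is evaluated depends on \<open>M\<close>
  itself, but it ranges over a countable type, so the preimage splits into countably many cases with
  a fixed list.\<close>

lemma measurable_val: "(\<lambda>M. val M e t) \<in> Str L \<rightarrow>\<^sub>M count_space UNIV"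
proof (induction t)
  case (Fn f ts)
  have "(\<lambda>M. map (\<lambda>t. val M e t) ts) \<in> Str L \<rightarrow>\<^sub>M count_space UNIV"
    by (intro measurable_map_list Fn)
  with measurable_snd_Str show ?case
    unfolding val.simps by (rule measurable_compose_countable[of "\<lambda>xs M. snd M (f, xs)"])
qed simp

lemma measurable_sat: "(\<lambda>M. sat M e p) \<in> Str L \<rightarrow>\<^sub>M count_space UNIV"
proof (induction p arbitrary: e)
  case (Eq s t)
  have "(\<lambda>M. a = val M e t) \<in> Str L \<rightarrow>\<^sub>M count_space UNIV" for a
    using measurable_val by (rule measurable_compose) simp
  then show ?case
    unfolding sat.simps using measurable_val[of e s L]
    by (rule measurable_compose_countable[of "\<lambda>a M. a = val M e t"])
next
  case (Rel r ts)
  have "(\<lambda>M. map (\<lambda>t. val M e t) ts) \<in> Str L \<rightarrow>\<^sub>M count_space UNIV"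
    by (intro measurable_map_list measurable_val)
  with measurable_fst_Str show ?case
    unfolding sat.simps by (rule measurable_compose_countable[of "\<lambda>xs M. fst M (r, xs)"])
next
  case (Neg p)
  from pred_intros_logic(2)[OF Neg] show ?case by simp
next
  case (Conj p q)
  from pred_intros_logic(3)[OF Conj] show ?case by simp
next
  case (All x p)
  from pred_intros_countable(1)[OF All] show ?case by simp
qed simp

lemma invariant_borel_class_Mod:
  assumes "is_theory L T" "countable T"
  shows "invariant_borel_class L (Mod L T)"
  unfolding invariant_borel_class_def
proof (intro conjI ballI impI)
  \<comment> \<open>There are uncountably many assignments; since sentences ignore them, a single
    one suffices, and the class becomes a countable intersection.\<close>
  have "sat M e p = sat M (\<lambda>_. 0) p" if "p \<in> T" for M e p
    using assms that by (intro sat_cong) (auto simp: is_theory_def)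
  then have "(\<forall>e. sat M e p) \<longleftrightarrow> sat M (\<lambda>_. 0) p" if "p \<in> T" for M p
    using that by blast
  then have "Mod L T = {M \<in> space (Str L). \<forall>p\<in>T. sat M (\<lambda>_. 0) p}"
    unfolding Mod_def by blast
  moreover have "\<dots> \<in> sets (Str L)"
    by (intro sets.sets_Collect_countable_All' predE measurable_sat assms(2))
  ultimately show "Mod L T \<in> sets (Str L)" by simp
next
  fix M N assume M: "M \<in> Mod L T" and N: "N \<in> space (Str L)" and "isomorphic L M N"
  then obtain g where g: "iso_via L g M N" by (auto simp: isomorphic_def)
  have "sat N e p" if "p \<in> T" for p e
  proof -
    have "(\<lambda>y. g (inv g (e y))) = e"
      using bij_is_surj[OF iso_viaD(1)[OF g]] by (simp add: surj_f_inv_f)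
    moreover have "sat M (\<lambda>y. inv g (e y)) p" using M that by (simp add: Mod_def)
    ultimately show ?thesis using sat_iso[OF g, of p "\<lambda>y. inv g (e y)"] that assms(1)
      by (simp add: is_theory_def)
  qed
  then show "N \<in> Mod L T" using N by (simp add: Mod_def)
qed

text \<open>Even first components stand for relation symbols, odd ones for the graphs of function symbols.\<close>

definition truth :: "lang \<Rightarrow> struct \<Rightarrow> nat \<times> nat list \<Rightarrow> bool" where
  "truth L M = (\<lambda>(l, xs).
     if even l then (l div 2, xs) \<in> rel_atoms L \<and> fst M (l div 2, xs)
     else xs \<noteq> [] \<and> (l div 2, butlast xs) \<in> fun_atoms L \<and> snd M (l div 2, butlast xs) = last xs)"

lemma truth_rel: "truth L M (2 * r, xs) \<longleftrightarrow> (r, xs) \<in> rel_atoms L \<and> fst M (r, xs)"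
  by (simp add: truth_def)

lemma truth_fun:
  "truth L M (2 * f + 1, xs @ [y]) \<longleftrightarrow> (f, xs) \<in> fun_atoms L \<and> snd M (f, xs) = y"
  by (simp add: truth_def)

lemma measurable_truth: "(\<lambda>M. truth L M a) \<in> Str L \<rightarrow>\<^sub>M count_space UNIV"
proof -
  note measurable_fst_Str[measurable] measurable_snd_Str[measurable]
  show ?thesis unfolding truth_def by (cases a) (simp split: if_split)
qed

text \<open>Injectivity of \<open>g\<close> makes preservation of a function the same as
  preservation of its graph. Off the atoms \<open>truth\<close> is false on both sides, so all
  tuples may be compared and the language disappears from the coding problem.\<close>

lemma iso_via_iff_truth:
  "iso_via L g M N \<longleftrightarrow> bij g \<and> (\<forall>l xs. truth L M (l, xs) \<longleftrightarrow> truth L N (l, map g xs))"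
    (is "?L \<longleftrightarrow> bij g \<and> ?R")
proof
  assume L: ?L
  then have bij: "bij g" by (rule iso_viaD)
  then have inj: "g x = g y \<longleftrightarrow> x = y" for x y
    by (simp add: bij_is_inj inj_eq)
  have rel: "(r, map g xs) \<in> rel_atoms L \<longleftrightarrow> (r, xs) \<in> rel_atoms L"
    and "fun": "(r, map g xs) \<in> fun_atoms L \<longleftrightarrow> (r, xs) \<in> fun_atoms L" for r xs
    by (auto simp: rel_atoms_def fun_atoms_def)
  have fst: "fst M (r, xs) \<longleftrightarrow> fst N (r, map g xs)" if "(r, xs) \<in> rel_atoms L" for r xs
    using L that by (rule iso_viaD)
  have snd: "snd N (r, map g xs) = g (snd M (r, xs))" if "(r, xs) \<in> fun_atoms L" for r xs
    using iso_viaD(3)[OF L that] by simp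
  have "truth L M (l, xs) \<longleftrightarrow> truth L N (l, map g xs)" for l xs
  proof (cases "even l")
    case True
    then show ?thesis using rel fst by (auto simp: truth_def)
  next
    case False
    then show ?thesis
      using "fun" snd inj by (cases xs rule: rev_cases) (auto simp: truth_def)
  qed
  with bij show "bij g \<and> ?R" by blast
next
  assume "bij g \<and> ?R"
  then have bij: "bij g" and R: "truth L M (l, xs) \<longleftrightarrow> truth L N (l, map g xs)" for l xs
    by blast+
  show ?L
    unfolding iso_via_def
  proof (intro conjI bij ballI; clarify)
    fix r xs assume "(r, xs) \<in> rel_atoms L"
    moreover from this have "(r, map g xs) \<in> rel_atoms L" by (simp add: rel_atoms_def)
    ultimately show "fst M (r, xs) \<longleftrightarrow> fst N (r, map g xs)"
      using R[of "2 * r" xs] by (simp add: truth_rel)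
  next
    fix f xs assume "(f, xs) \<in> fun_atoms L"
    then show "g (snd M (f, xs)) = snd N (f, map g xs)"
      \<comment> \<open>The tuple extended by the actual value in \<open>M\<close> lies in the
        graph, and its image then names the value in \<open>N\<close>.\<close>
      using R[of "2 * f + 1" "xs @ [snd M (f, xs)]"]
      unfolding map_append list.map truth_fun by simp
  qed
qed

section \<open>Models of cross-cutting equivalence relations from points of a product\<close>

lemma countable_T_h: "countable (T_h h)"
proof -
  have "countable (equivalence_axioms \<phi> \<union> {exactly_classes \<phi> k})" for \<phi> k
    by (simp add: equivalence_axioms_def)
  moreover have "countable {F :: nat set. finite F \<and> F \<noteq> {}}"
    by (rule countable_subset[OF _ countable_Collect_finite]) auto
  ultimately show ?thesis unfolding T_h_def by (intro countable_Un countable_UN) auto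
qed

text \<open>\<open>X\<close> need not be injective: elements with the same point are equivalent
  under every relation, and the number of such copies will carry information.\<close>

definition coord_struct :: "(nat \<Rightarrow> nat \<Rightarrow> nat) \<Rightarrow> struct" where
  "coord_struct X =
     ((\<lambda>(n, xs)\<in>rel_atoms L_E. X (xs ! 0) n = X (xs ! 1) n), (\<lambda>_. undefined))"

lemma fst_coord_struct [simp]: "fst (coord_struct X) (n, [x, y]) \<longleftrightarrow> X x n = X y n"
  by (simp add: coord_struct_def rel_atoms_def L_E_def)

lemma coord_struct_space: "coord_struct X \<in> space (Str L_E)"
  by (auto simp: coord_struct_def Str_def space_pair_measure space_PiM fun_atoms_def L_E_def
      PiE_def extensional_def)

text \<open>The classes of the relation for \<open>F\<close> correspond to the restrictions to
  \<open>F\<close> that occur among the points; density says that every tuple of the finite product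
  occurs.\<close>

lemma coord_struct_in_Mod:
  assumes h: "\<And>n. h n \<noteq> 0" and X: "\<And>x n. X x n < h n"
    and dense: "\<And>F t. finite F \<Longrightarrow> (\<And>n. t n < h n) \<Longrightarrow> \<exists>x. \<forall>n\<in>F. X x n = t n"
  shows "coord_struct X \<in> Mod L_E (T_h h)"
proof -
  have eq: "equiv UNIV {(x, y). \<forall>n\<in>F. X x n = X y n} \<and>
      card (UNIV // {(x, y). \<forall>n\<in>F. X x n = X y n}) = (\<Prod>n\<in>F. h n)" if F: "finite F" for F
  proof
    let ?r = "{(x, y). \<forall>n\<in>F. X x n = X y n}"
    show eq: "equiv UNIV ?r" by (auto simp: equiv_def refl_on_def sym_def trans_def)
    define f where "f x = restrict (X x) F" for x
    have "(\<forall>n\<in>F. X x n = X y n) \<longleftrightarrow> f y = f x" for x y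
    proof
      assume "f y = f x"
      then have "f x n = f y n" for n by simp
      moreover have "f z n = X z n" if "n \<in> F" for z n using that by (simp add: f_def)
      ultimately show "\<forall>n\<in>F. X x n = X y n" by metis
    qed (simp add: f_def cong: restrict_cong)
    then have r: "?r `` {x} = f -` {f x}" for x by auto
    have f: "range f = (\<Pi>\<^sub>E n\<in>F. {..<h n})"
    proof
      show "range f \<subseteq> (\<Pi>\<^sub>E n\<in>F. {..<h n})" using X by (auto simp: f_def)
      show "(\<Pi>\<^sub>E n\<in>F. {..<h n}) \<subseteq> range f"
      proof
        fix t assume t: "t \<in> (\<Pi>\<^sub>E n\<in>F. {..<h n})"
        \<comment> \<open>The density hypothesis wants a total tuple below \<open>h\<close>; 0 is
          admissible outside \<open>F\<close> because \<open>h\<close> is nonzero.\<close>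
        have "(if n \<in> F then t n else 0) < h n" for n
          using t h[of n] by (auto simp: PiE_def)
        from dense[OF F this] obtain x where "\<forall>n\<in>F. X x n = t n" by auto
        then have "f x = t" using t by (auto simp: f_def fun_eq_iff PiE_def extensional_def)
        then show "t \<in> range f" by blast
      qed
    qed
    have "bij_betw (\<lambda>t. f -` {t}) (range f) (UNIV // ?r)"
    proof (rule bij_betw_imageI)
      show "inj_on (\<lambda>t. f -` {t}) (range f)" by (rule inj_onI) blast
      show "(\<lambda>t. f -` {t}) ` range f = UNIV // ?r" unfolding quotient_def r by auto
    qed
    then have "card (UNIV // ?r) = card (range f)" by (simp add: bij_betw_same_card)
    also have "\<dots> = (\<Prod>n\<in>F. h n)" unfolding f using F by (simp add: card_PiE)
    finally show "card (UNIV // ?r) = (\<Prod>n\<in>F. h n)" .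
  qed
  \<comment> \<open>The axioms for a single relation are the case of a singleton
    \<open>F\<close>.\<close>
  from eq[of "{n}" for n] eq show ?thesis
    by (simp add: Mod_T_h h coord_struct_space)
qed

lemma isomorphic_coord_struct_iff:
  "isomorphic L_E (coord_struct X) (coord_struct Y) \<longleftrightarrow>
     (\<exists>g. bij g \<and> (\<forall>n x y. X x n = X y n \<longleftrightarrow> Y (g x) n = Y (g y) n))"
proof -
  have rel: "(\<forall>a\<in>rel_atoms L_E. P a) \<longleftrightarrow> (\<forall>n x y. P (n, [x, y]))" for P
  proof
    assume P: "\<forall>n x y. P (n, [x, y])"
    show "\<forall>a\<in>rel_atoms L_E. P a"
    proof
      fix a assume "a \<in> rel_atoms L_E"
      then obtain n x y where "a = (n, [x, y])"
        by (auto simp: rel_atoms_def L_E_def numeral_2_eq_2 length_Suc_conv)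
      then show "P a" using P by blast
    qed
  qed (simp add: rel_atoms_def L_E_def)
  have "iso_via L_E g (coord_struct X) (coord_struct Y) \<longleftrightarrow> bij g \<and>
      (\<forall>n x y. X x n = X y n \<longleftrightarrow> Y (g x) n = Y (g y) n)" for g
    unfolding iso_via_def rel by (simp add: fun_atoms_def L_E_def)
  then show ?thesis by (simp add: isomorphic_def)
qed

lemma measurable_coord_struct:
  assumes "\<And>x n. (\<lambda>w. X w x n) \<in> M \<rightarrow>\<^sub>M count_space UNIV"
  shows "(\<lambda>w. coord_struct (X w)) \<in> M \<rightarrow>\<^sub>M Str L_E"
proof -
  have "(\<lambda>w. X w x n = X w y n) \<in> M \<rightarrow>\<^sub>M count_space UNIV" for x y n
    by (rule measurable_compose_countable[of "\<lambda>a w. a = X w y n", OF measurable_compose[OF assms] assms]) simp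
  then have "(\<lambda>w. \<lambda>(n, xs)\<in>rel_atoms L_E. X w (xs ! 0) n = X w (xs ! 1) n)
      \<in> M \<rightarrow>\<^sub>M (\<Pi>\<^sub>M a\<in>rel_atoms L_E. count_space UNIV)"
    by (intro measurable_restrict) (auto simp: case_prod_beta)
  moreover have "(\<lambda>_. \<lambda>_. undefined) \<in> M \<rightarrow>\<^sub>M (\<Pi>\<^sub>M a\<in>fun_atoms L_E. count_space UNIV)"
    by (intro measurable_const) (auto simp: space_PiM PiE_def extensional_def fun_atoms_def L_E_def)
  ultimately show ?thesis unfolding coord_struct_def Str_def by (rule measurable_Pair)
qed

text \<open>The part of \<open>\<tau>\<close> that stays below \<open>k\<close> is a partial
  injection of a finite set; its domain and image have complements of equal size, which can be
  matched arbitrarily.\<close>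

lemma perm_extends_partial:
  assumes "inj \<tau>"
  shows "\<exists>g. bij_betw g {..<k :: nat} {..<k} \<and> (\<forall>i<k. \<tau> i < k \<longrightarrow> g i = \<tau> i)"
proof -
  let ?A = "{i. i < k \<and> \<tau> i < k}"
  have inj: "inj_on \<tau> ?A" using assms by (rule inj_on_subset) simp
  have "card ({..<k} - ?A) = card ({..<k} - \<tau> ` ?A)"
    by (subst (1 2) card_Diff_subset) (auto simp: card_image[OF inj])
  then obtain f where f: "bij_betw f ({..<k} - ?A) ({..<k} - \<tau> ` ?A)"
    using finite_same_card_bij[of "{..<k} - ?A" "{..<k} - \<tau> ` ?A"] by auto
  define g where "g i = (if i \<in> ?A then \<tau> i else f i)" for i
  have "bij_betw g ?A (\<tau> ` ?A)"
    using inj_on_imp_bij_betw[OF inj] by (subst bij_betw_cong[of _ _ \<tau>]) (auto simp: g_def)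
  moreover have "bij_betw g ({..<k} - ?A) ({..<k} - \<tau> ` ?A)"
    using f by (subst bij_betw_cong[of _ _ f]) (auto simp: g_def)
  ultimately have "bij_betw g (?A \<union> ({..<k} - ?A)) (\<tau> ` ?A \<union> ({..<k} - \<tau> ` ?A))"
    by (rule bij_betw_combine) auto
  moreover have "?A \<union> ({..<k} - ?A) = {..<k}" "\<tau> ` ?A \<union> ({..<k} - \<tau> ` ?A) = {..<k}" by auto
  ultimately have "bij_betw g {..<k} {..<k}" by simp
  then show ?thesis by (intro exI[of _ g]) (simp add: g_def)
qed

definition slot :: "nat \<Rightarrow> nat" where
  "slot n = fst (prod_decode n)"

lemma INFM_slot: "\<exists>\<^sub>\<infinity>n. slot n = k"
  unfolding INFM_nat_le
proof
  fix m
  show "\<exists>n\<ge>m. slot n = k"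
    by (rule exI[of _ "prod_encode (k, m)"]) (simp add: slot_def le_prod_encode_2)
qed

text \<open>
  \<open>weight i\<close> is the number of copies of the constant sequence \<open>i\<close>; it determines the even \<open>i\<close>, and all
  odd \<open>i\<close> look alike. \<open>Inl (i, k)\<close> labels the \<open>k\<close>-th copy, \<open>Inr (l, xs)\<close> an atom of the coded structure.
\<close>

definition weight :: "nat \<Rightarrow> nat" where
  "weight i = (if odd i then 2 else i + 3)"

type_synonym label = "nat \<times> nat + nat \<times> nat list"

definition labels :: "label set" where
  "labels = Inl ` (SIGMA i:UNIV. {..<weight i}) \<union> range Inr"

lemma Inl_in_labels [simp]: "Inl (i, k) \<in> labels \<longleftrightarrow> k < weight i"
  by (auto simp: labels_def)

lemma Inr_in_labels [simp]: "Inr a \<in> labels"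
  by (simp add: labels_def)

lemma infinite_labels: "infinite labels"
proof
  assume "finite labels"
  then have "finite (range (Inr :: nat \<times> nat list \<Rightarrow> label))"
    by (rule finite_subset[rotated]) (auto simp: labels_def)
  then have "finite (UNIV :: (nat \<times> nat list) set)" by (rule finite_imageD) simp
  then show False by (simp add: finite_prod)
qed

section \<open>Sequences as points, and the finite modifications of these points\<close>

locale class_numbers =
  fixes h :: "nat \<Rightarrow> nat"
  assumes strict_mono: "strict_mono h" and nonzero: "\<And>n. h n \<noteq> 0"
begin

lemma le_h: "n \<le> h n"
  using strict_mono by (rule strict_mono_imp_increasing)

text \<open>The default 0 keeps the point inside the product. For each fixed entry of
  \<open>u\<close> it is used at only finitely many coordinates, because
  \<open>n \<le> h n\<close>.\<close>

definition center :: "(nat \<Rightarrow> nat) \<Rightarrow> nat \<Rightarrow> nat" where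
  "center u n = (if u (slot n) < h n then u (slot n) else 0)"

lemma center_less: "center u n < h n"
  using nonzero[of n] by (simp add: center_def)

lemma MOST_center: "\<forall>\<^sub>\<infinity>n. slot n = k \<longrightarrow> center u n = u k"
  unfolding MOST_nat
proof (intro exI allI impI)
  fix n assume "u k < n" "slot n = k"
  then show "center u n = u k" using le_h[of n] by (simp add: center_def)
qed

text \<open>Every entry is displayed at infinitely many coordinates, hence also at one beyond all
  finitely many exceptions.\<close>

lemma center_eq_iff: "(\<forall>\<^sub>\<infinity>n. center u n = center v n) \<longleftrightarrow> u = v"
proof
  assume "\<forall>\<^sub>\<infinity>n. center u n = center v n"
  show "u = v"
  proof
    fix k
    have "\<forall>\<^sub>\<infinity>n. slot n = k \<longrightarrow> u k = v k"
      using \<open>\<forall>\<^sub>\<infinity>n. center u n = center v n\<close> MOST_center[of k u] MOST_center[of k v]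
      by eventually_elim auto
    with INFM_slot[of k] have "\<exists>\<^sub>\<infinity>n :: nat. u k = v k" by (rule frequently_rev_mp)
    then show "u k = v k" by simp
  qed
qed simp

text \<open>
  Parametrizing the finite modifications of a point by offsets makes the universe, and its
  enumeration, independent of the structure to be coded; so Borel measurability is immediate.
\<close>

definition offsets :: "(nat \<Rightarrow> nat) set" where
  "offsets = {d. (\<forall>n. d n < h n) \<and> (\<forall>\<^sub>\<infinity>n. d n = 0)}"

lemma countable_offsets: "countable offsets"
proof (rule countable_subset)
  show "offsets \<subseteq> range (\<lambda>w n. if n < length w then w ! n else 0)"
  proof
    fix d assume "d \<in> offsets"
    then obtain m where "\<And>n. n \<ge> m \<Longrightarrow> d n = 0" by (auto simp: offsets_def MOST_nat_le)
    then have "d = (\<lambda>n. if n < length (map d [0..<m]) then map d [0..<m] ! n else 0)"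
      by (auto simp: fun_eq_iff)
    then show "d \<in> range (\<lambda>w n. if n < length w then w ! n else 0)" by blast
  qed
qed simp

text \<open>Keeping the label in the pair makes equal points with different labels different
  elements.\<close>

definition points :: "(label \<Rightarrow> nat \<Rightarrow> nat) \<Rightarrow> (label \<times> (nat \<Rightarrow> nat)) set" where
  "points u = {(\<iota>, z). \<iota> \<in> labels \<and> (\<forall>n. z n < h n) \<and> (\<forall>\<^sub>\<infinity>n. z n = center (u \<iota>) n)}"

text \<open>Each coordinate is treated as a residue modulo \<open>h n\<close>: the offset is the
  cyclic difference from the center, and it vanishes exactly where the point agrees with the
  center.\<close>

lemma bij_betw_points:
  "bij_betw (\<lambda>(\<iota>, d). (\<iota>, \<lambda>n. (center (u \<iota>) n + d n) mod h n)) (labels \<times> offsets) (points u)"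
proof -
  let ?f = "\<lambda>(\<iota>, d). (\<iota>, \<lambda>n. (center (u \<iota>) n + d n) mod h n)"
  let ?g = "\<lambda>(\<iota>, z). (\<iota>, \<lambda>n. (z n + (h n - center (u \<iota>) n)) mod h n)"
  have 1: "((c + d) mod k + (k - c)) mod k = d" if "c < k" "d < k" for c d k :: nat
  proof -
    have "((c + d) mod k + (k - c)) mod k = (c + d + (k - c)) mod k" by (rule mod_add_left_eq)
    also have "c + d + (k - c) = d + k" using that by simp
    finally show ?thesis using that by simp
  qed
  have 2: "(c + (z + (k - c)) mod k) mod k = z" if "c < k" "z < k" for c z k :: nat
  proof -
    have "(c + (z + (k - c)) mod k) mod k = (c + (z + (k - c))) mod k" by (rule mod_add_right_eq)
    also have "c + (z + (k - c)) = z + k" using that by simp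
    finally show ?thesis using that by simp
  qed
  show ?thesis
  proof (rule bij_betw_byWitness[where f' = ?g])
    show "\<forall>a\<in>labels \<times> offsets. ?g (?f a) = a"
      by (auto simp: offsets_def 1 center_less)
    show "\<forall>a\<in>points u. ?f (?g a) = a"
      by (auto simp: points_def 2 center_less)
    have "\<forall>\<^sub>\<infinity>n. (center v n + d n) mod h n = center v n" if "\<forall>\<^sub>\<infinity>n. d n = 0" for v d
      using that by eventually_elim (simp add: center_less)
    then show "?f ` (labels \<times> offsets) \<subseteq> points u"
      using nonzero by (auto simp: points_def offsets_def)
    have "\<forall>\<^sub>\<infinity>n. (z n + (h n - center v n)) mod h n = 0" if "\<forall>\<^sub>\<infinity>n. z n = center v n" for v z
      using that by eventually_elim (simp add: center_less less_imp_le)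
    then show "?g ` points u \<subseteq> labels \<times> offsets"
      using nonzero by (auto simp: points_def offsets_def)
  qed
qed

definition enum :: "nat \<Rightarrow> label \<times> (nat \<Rightarrow> nat)" where
  "enum = from_nat_into (labels \<times> offsets)"

lemma bij_betw_enum: "bij_betw enum UNIV (labels \<times> offsets)"
proof -
  have "(\<lambda>_. 0) \<in> offsets" using nonzero by (simp add: offsets_def)
  then have "infinite (labels \<times> offsets)"
    using infinite_labels by (auto simp: finite_cartesian_product_iff)
  moreover have "countable (labels \<times> offsets)"
    by (intro countable_SIGMA countable_offsets) auto
  ultimately show ?thesis unfolding enum_def by (intro bij_betw_from_nat_into)
qed

definition label :: "nat \<Rightarrow> label" where
  "label x = fst (enum x)"

definition pt :: "(label \<Rightarrow> nat \<Rightarrow> nat) \<Rightarrow> nat \<Rightarrow> nat \<Rightarrow> nat" where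
  "pt u x n = (center (u (label x)) n + snd (enum x) n) mod h n"

lemma bij_betw_pt: "bij_betw (\<lambda>x. (label x, pt u x)) UNIV (points u)"
proof -
  have "(\<lambda>x. (label x, pt u x)) =
      (\<lambda>(\<iota>, d). (\<iota>, \<lambda>n. (center (u \<iota>) n + d n) mod h n)) \<circ> enum"
    by (auto simp: fun_eq_iff label_def pt_def case_prod_beta)
  then show ?thesis using bij_betw_trans[OF bij_betw_enum bij_betw_points] by simp
qed

lemma pt_in_points: "(label x, pt u x) \<in> points u"
  using bij_betw_pt[of u] by (auto simp: bij_betw_def)

lemma label_in_labels: "label x \<in> labels"
  using pt_in_points[of x undefined] by (simp add: points_def)

lemma pt_less: "pt u x n < h n"
  using pt_in_points[of x u] by (simp add: points_def)

lemma MOST_pt: "\<forall>\<^sub>\<infinity>n. pt u x n = center (u (label x)) n"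
  using pt_in_points[of x u] by (simp add: points_def)

lemma points_obtain:
  assumes "(\<iota>, z) \<in> points u"
  obtains x where "label x = \<iota>" "pt u x = z"
proof -
  have "(\<iota>, z) \<in> (\<lambda>x. (label x, pt u x)) ` UNIV"
    using assms bij_betw_pt[of u] by (simp only: bij_betw_def)
  then show ?thesis using that by auto
qed

lemma label_pt_inject: "label x = label y \<Longrightarrow> pt u x = pt u y \<Longrightarrow> x = y"
  using bij_betw_pt[of u] by (auto simp: bij_betw_def dest: injD)

lemma surj_label:
  assumes "\<iota> \<in> labels"
  obtains x where "label x = \<iota>"
proof -
  have "(\<iota>, center (\<lambda>_. 0)) \<in> points (\<lambda>_ _. 0)"
    using assms by (simp add: points_def center_less)
  then show ?thesis using that by (rule points_obtain)
qed

lemma MOST_pt_eq_iff: "(\<forall>\<^sub>\<infinity>n. pt u x n = pt u y n) \<longleftrightarrow> u (label x) = u (label y)"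
proof -
  have "\<forall>\<^sub>\<infinity>n. (pt u x n = pt u y n) = (center (u (label x)) n = center (u (label y)) n)"
    using MOST_pt[of u x] MOST_pt[of u y] by eventually_elim simp
  then show ?thesis unfolding center_eq_iff[symmetric] by (rule eventually_subst)
qed

lemma pt_dense:
  assumes "finite F" "\<And>n. t n < h n"
  shows "\<exists>x. \<forall>n\<in>F. pt u x n = t n"
proof -
  \<comment> \<open>Any label would do: modifying its center on \<open>F\<close> alone already
    realizes the prescribed tuple.\<close>
  let ?\<iota> = "Inr (0, []) :: label"
  let ?z = "\<lambda>n. if n \<in> F then t n else center (u ?\<iota>) n"
  have "\<forall>\<^sub>\<infinity>n. n \<notin> F"
    using assms(1) by (simp add: MOST_iff_finiteNeg)
  then have "\<forall>\<^sub>\<infinity>n. ?z n = center (u ?\<iota>) n" by eventually_elim simp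
  then have "(?\<iota>, ?z) \<in> points u"
    using assms(2) by (simp add: points_def center_less)
  then obtain x where "pt u x = ?z" by (rule points_obtain)
  then have "\<forall>n\<in>F. pt u x n = t n" by simp
  then show ?thesis ..
qed

text \<open>Equal points come from equal sequences, and each label of a given sequence carries every
  finite modification exactly once. So the multiplicity of a point counts the labels of its
  sequence.\<close>

lemma card_pt_eq:
  "card {y. pt u y = pt u x} = card {\<iota> \<in> labels. u \<iota> = u (label x)}"
proof (rule bij_betw_same_card[of label], rule bij_betw_imageI)
  show "inj_on label {y. pt u y = pt u x}"
    by (rule inj_onI) (use label_pt_inject[of _ _ u] in auto)
  show "label ` {y. pt u y = pt u x} = {\<iota> \<in> labels. u \<iota> = u (label x)}"
  proof (intro subset_antisym subsetI)
    fix \<iota> assume "\<iota> \<in> label ` {y. pt u y = pt u x}"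
    then obtain y where "\<iota> = label y" "pt u y = pt u x" by auto
    then show "\<iota> \<in> {\<iota> \<in> labels. u \<iota> = u (label x)}"
      using MOST_pt_eq_iff[of u y x] label_in_labels by simp
  next
    fix \<iota> assume "\<iota> \<in> {\<iota> \<in> labels. u \<iota> = u (label x)}"
    then have "(\<iota>, pt u x) \<in> points u"
      using pt_in_points[of x u] by (simp add: points_def)
    then obtain y where "label y = \<iota>" "pt u y = pt u x" by (rule points_obtain)
    then show "\<iota> \<in> label ` {y. pt u y = pt u x}" by auto
  qed
qed

text \<open>Finite permutations approximating \<open>\<tau>\<close> act coordinatewise, so they
  preserve and reflect every equality of coordinates. As each sequence has finite range, they carry
  its center to the center of the relabelled sequence at almost all coordinates, hence finite
  modifications to finite modifications.\<close>

lemma bij_pt_of_relabelling: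
  assumes \<beta>: "bij_betw \<beta> labels labels" and \<tau>: "inj \<tau>"
    and v: "\<And>\<iota>. \<iota> \<in> labels \<Longrightarrow> v (\<beta> \<iota>) = \<tau> \<circ> u \<iota>"
    and fin: "\<And>\<iota>. \<iota> \<in> labels \<Longrightarrow> finite (range (u \<iota>))"
  shows "\<exists>g. bij g \<and> (\<forall>n x y. pt u x n = pt u y n \<longleftrightarrow> pt v (g x) n = pt v (g y) n)"
proof -
  have "\<forall>n. \<exists>g. bij_betw g {..<h n} {..<h n} \<and> (\<forall>i<h n. \<tau> i < h n \<longrightarrow> g i = \<tau> i)"
    using perm_extends_partial[OF \<tau>] by blast
  from choice[OF this] obtain \<gamma> where *: "\<forall>n. bij_betw (\<gamma> n) {..<h n} {..<h n} \<and>
      (\<forall>i<h n. \<tau> i < h n \<longrightarrow> \<gamma> n i = \<tau> i)" ..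
  then have \<gamma>: "bij_betw (\<gamma> n) {..<h n} {..<h n}" for n by simp
  from * have \<gamma>_eq: "\<gamma> n i = \<tau> i" if "i < h n" "\<tau> i < h n" for n i
    using that by simp
  have MOST_\<gamma>: "\<forall>\<^sub>\<infinity>n. center (v (\<beta> \<iota>)) n = \<gamma> n (center (u \<iota>) n)" if "\<iota> \<in> labels" for \<iota>
    unfolding MOST_nat
  proof (intro exI allI impI)
    \<comment> \<open>Beyond this bound all values of \<open>u \<iota>\<close> and their images
      under \<open>\<tau>\<close> lie below \<open>h n\<close>; neither center uses the default, and
      \<open>\<gamma> n\<close> agrees with \<open>\<tau>\<close> on the values that occur.\<close>
    fix n assume n: "Max (range (u \<iota>) \<union> \<tau> ` range (u \<iota>)) < n"
    have "w < h n" if "w \<in> range (u \<iota>) \<union> \<tau> ` range (u \<iota>)" for w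
      using le_less_trans[OF Max_ge[OF _ that] n] fin[OF \<open>\<iota> \<in> labels\<close>] le_h[of n] by simp
    then have "u \<iota> k < h n" "\<tau> (u \<iota> k) < h n" for k by auto
    then show "center (v (\<beta> \<iota>)) n = \<gamma> n (center (u \<iota>) n)"
      by (simp add: center_def v[OF that] \<gamma>_eq)
  qed
  let ?\<phi> = "\<lambda>(\<iota>, z). (\<beta> \<iota>, \<lambda>n. \<gamma> n (z n))"
  let ?\<psi> = "\<lambda>(\<kappa>, z). (inv_into labels \<beta> \<kappa>, \<lambda>n. inv_into {..<h n} (\<gamma> n) (z n))"
  have \<gamma>_less: "\<gamma> n i < h n" "inv_into {..<h n} (\<gamma> n) i < h n"
    and \<gamma>_inv: "\<gamma> n (inv_into {..<h n} (\<gamma> n) i) = i" "inv_into {..<h n} (\<gamma> n) (\<gamma> n i) = i"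
    if "i < h n" for i n
    using bij_betw_apply[OF \<gamma>[of n], of i] bij_betw_apply[OF bij_betw_inv_into[OF \<gamma>[of n]], of i]
      bij_betw_inv_into_left[OF \<gamma>[of n], of i] bij_betw_inv_into_right[OF \<gamma>[of n], of i] that
    by simp_all
  have \<beta>_in: "\<beta> \<iota> \<in> labels" "inv_into labels \<beta> \<iota> \<in> labels"
    and \<beta>_inv: "\<beta> (inv_into labels \<beta> \<iota>) = \<iota>" "inv_into labels \<beta> (\<beta> \<iota>) = \<iota>" if "\<iota> \<in> labels" for \<iota>
    using bij_betw_apply[OF \<beta> that] bij_betw_apply[OF bij_betw_inv_into[OF \<beta>] that]
      bij_betw_inv_into_left[OF \<beta> that] bij_betw_inv_into_right[OF \<beta> that]
    by simp_all
  have "bij_betw ?\<phi> (points u) (points v)"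
  proof (rule bij_betw_byWitness[where f' = ?\<psi>])
    show "\<forall>a\<in>points u. ?\<psi> (?\<phi> a) = a" by (auto simp: points_def \<gamma>_inv \<beta>_inv)
    show "\<forall>a\<in>points v. ?\<phi> (?\<psi> a) = a" by (auto simp: points_def \<gamma>_inv \<beta>_inv)
    show "?\<phi> ` points u \<subseteq> points v"
    proof clarify
      fix \<iota> z assume "(\<iota>, z) \<in> points u"
      then have \<iota>: "\<iota> \<in> labels" and z: "\<And>n. z n < h n" and *: "\<forall>\<^sub>\<infinity>n. z n = center (u \<iota>) n"
        by (auto simp: points_def)
      have "\<forall>\<^sub>\<infinity>n. \<gamma> n (z n) = center (v (\<beta> \<iota>)) n"
        using * MOST_\<gamma>[OF \<iota>] by eventually_elim simp
      then show "(\<beta> \<iota>, \<lambda>n. \<gamma> n (z n)) \<in> points v"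
        using \<iota> z by (simp add: points_def \<beta>_in \<gamma>_less)
    qed
    show "?\<psi> ` points v \<subseteq> points u"
    proof clarify
      fix \<kappa> z assume "(\<kappa>, z) \<in> points v"
      then have \<kappa>: "\<kappa> \<in> labels" and z: "\<And>n. z n < h n" and *: "\<forall>\<^sub>\<infinity>n. z n = center (v \<kappa>) n"
        by (auto simp: points_def)
      let ?\<iota> = "inv_into labels \<beta> \<kappa>"
      have "\<forall>\<^sub>\<infinity>n. inv_into {..<h n} (\<gamma> n) (z n) = center (u ?\<iota>) n"
        using * MOST_\<gamma>[OF \<beta>_in(2)[OF \<kappa>]]
        by eventually_elim (simp add: \<beta>_inv(1)[OF \<kappa>] \<gamma>_inv center_less)
      then show "(?\<iota>, \<lambda>n. inv_into {..<h n} (\<gamma> n) (z n)) \<in> points u"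
        using \<kappa> z by (simp add: points_def \<beta>_in \<gamma>_less)
    qed
  qed
  define g where "g = inv_into UNIV (\<lambda>x. (label x, pt v x)) \<circ> (?\<phi> \<circ> (\<lambda>x. (label x, pt u x)))"
  have bij: "bij g"
    unfolding g_def
    by (intro bij_betw_trans[OF bij_betw_trans[OF bij_betw_pt] bij_betw_inv_into[OF bij_betw_pt]])
      (rule \<open>bij_betw ?\<phi> (points u) (points v)\<close>)
  have "(label (g x), pt v (g x)) = ?\<phi> (label x, pt u x)" for x
  proof -
    have "?\<phi> (label x, pt u x) \<in> points v"
      using \<open>bij_betw ?\<phi> (points u) (points v)\<close> pt_in_points by (rule bij_betw_apply)
    from bij_betw_inv_into_right[OF bij_betw_pt this] show ?thesis by (simp add: g_def)
  qed
  then have pt: "pt v (g x) n = \<gamma> n (pt u x n)" for x n by simp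
  have "\<gamma> n (pt u x n) = \<gamma> n (pt u y n) \<longleftrightarrow> pt u x n = pt u y n" for n x y
    using \<gamma>_inv(2)[OF pt_less, of n u x] \<gamma>_inv(2)[OF pt_less, of n u y] by metis
  then have "\<forall>n x y. pt u x n = pt u y n \<longleftrightarrow> pt v (g x) n = pt v (g y) n"
    by (simp add: pt)
  with bij show ?thesis by blast
qed

end

section \<open>Coding arbitrary structures\<close>

text \<open>
  Both truth values of an atom are represented by a sequence (with second entry 2 or 4), so the
  coded structure only influences where the points are, not how many there are. The nonzero second
  entry and the final zeros keep these sequences from being constant.
\<close>

fun address :: "(nat \<times> nat list \<Rightarrow> bool) \<Rightarrow> label \<Rightarrow> nat \<Rightarrow> nat" where
  "address R (Inl (i, k)) = (\<lambda>_. i)"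
| "address R (Inr (l, xs)) = (\<lambda>k. case k of
       0 \<Rightarrow> 2 * l
     | Suc 0 \<Rightarrow> (if R (l, xs) then 2 else 4)
     | Suc (Suc j) \<Rightarrow> (if j < length xs then 2 * xs ! j + 1 else 0))"

lemma finite_range_address: "finite (range (address R \<iota>))"
proof (cases \<iota>)
  case (Inl p)
  then show ?thesis by (cases p) simp
next
  case (Inr a)
  obtain l xs where a: "a = (l, xs)" by (cases a)
  have "address R \<iota> k \<in> {0, 2, 4, 2 * l} \<union> (\<lambda>x. 2 * x + 1) ` set xs" for k
    by (auto simp: Inr a split: nat.split)
  then have "range (address R \<iota>) \<subseteq> {0, 2, 4, 2 * l} \<union> (\<lambda>x. 2 * x + 1) ` set xs"
    by (rule image_subsetI)
  then show ?thesis by (rule finite_subset) simp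
qed

lemma address_Inr_neq_const: "address R (Inr a) \<noteq> (\<lambda>_. i)"
proof
  assume *: "address R (Inr a) = (\<lambda>_. i)"
  obtain l xs where "a = (l, xs)" by (cases a)
  with fun_cong[OF *, of "Suc 0"] fun_cong[OF *, of "Suc (Suc (length xs))"] show False
    by (auto split: if_splits)
qed

lemma address_Inr_inject:
  "address R (Inr a) = address S (Inr b) \<longleftrightarrow> a = b \<and> (R a \<longleftrightarrow> S b)"
proof
  assume *: "address R (Inr a) = address S (Inr b)"
  obtain l xs m ys where ab: "a = (l, xs)" "b = (m, ys)" by (cases a, cases b)
  have nth: "(if k < length xs then 2 * xs ! k + 1 else 0) = (if k < length ys then 2 * ys ! k + 1 else 0)" for k
    using fun_cong[OF *, of "Suc (Suc k)"] by (simp add: ab)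
  \<comment> \<open>Coded list entries are odd while the padding is 0, so the nonzero positions
    determine the length.\<close>
  have lt: "k < length xs \<longleftrightarrow> k < length ys" for k
    using nth[of k] by (auto split: if_splits)
  have len: "length xs = length ys"
    using lt[of "length xs"] lt[of "length ys"] by simp
  have "xs = ys"
  proof (rule nth_equalityI[OF len])
    fix k assume "k < length xs"
    then show "xs ! k = ys ! k" using nth[of k] len by simp
  qed
  moreover have "l = m" using fun_cong[OF *, of 0] by (simp add: ab)
  moreover have "R a \<longleftrightarrow> S b"
    using fun_cong[OF *, of "Suc 0"] by (simp add: ab split: if_splits)
  ultimately show "a = b \<and> (R a \<longleftrightarrow> S b)" using ab by simp
next
  assume *: "a = b \<and> (R a \<longleftrightarrow> S b)"
  obtain m ys where "b = (m, ys)" by (cases b)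
  with * show "address R (Inr a) = address S (Inr b)" by auto
qed

lemma card_address_Inl:
  "card {\<kappa> \<in> labels. address R \<kappa> = address R (Inl (i, k))} = weight i"
proof -
  have "{\<kappa> \<in> labels. address R \<kappa> = address R (Inl (i, k))} = Inl ` ({i} \<times> {..<weight i})"
    (is "?A = ?B")
  proof (rule set_eqI)
    fix \<kappa> show "\<kappa> \<in> ?A \<longleftrightarrow> \<kappa> \<in> ?B"
    proof (cases \<kappa>)
      case (Inl p)
      then show ?thesis by (cases p) (auto simp: fun_eq_iff)
    next
      case (Inr a)
      then show ?thesis by (auto simp: address_Inr_neq_const)
    qed
  qed
  then show ?thesis by (simp add: card_image)
qed

lemma card_address_Inr:
  "card {\<kappa> \<in> labels. address R \<kappa> = address R (Inr a)} = 1"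
proof -
  have "{\<kappa> \<in> labels. address R \<kappa> = address R (Inr a)} = {Inr a}" (is "?A = ?B")
  proof (rule set_eqI)
    fix \<kappa> show "\<kappa> \<in> ?A \<longleftrightarrow> \<kappa> \<in> ?B"
    proof (cases \<kappa>)
      case (Inl p)
      then show ?thesis by (cases p) (simp add: address_Inr_neq_const[symmetric] del: address.simps(2))
    next
      case (Inr b)
      then show ?thesis by (auto simp: address_Inr_inject)
    qed
  qed
  then show ?thesis by simp
qed

text \<open>Constant sequences have multiplicity \<open>weight i\<close>, which is at least 2,
  whereas the sequence of an atom has multiplicity 1; multiplicity therefore recognizes
  constancy.\<close>

lemma address_const_transfer:
  assumes "card {\<kappa> \<in> labels. address R \<kappa> = address R \<iota>} = card {\<kappa> \<in> labels. address S \<kappa> = address S \<iota>'}"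
    and "address R \<iota> = (\<lambda>_. i)"
  shows "\<exists>j. address S \<iota>' = (\<lambda>_. j) \<and> weight j = weight i"
proof -
  have w: "card {\<kappa> \<in> labels. address R \<kappa> = address R \<iota>} = weight i"
    using card_address_Inl[of R i 0] by (simp add: assms(2))
  show ?thesis
  proof (cases \<iota>')
    case (Inl p)
    then obtain j k where "\<iota>' = Inl (j, k)" by (cases p) auto
    with w assms(1) card_address_Inl[of S j k] show ?thesis by auto
  next
    case (Inr a)
    with w assms(1) card_address_Inr[of S a] show ?thesis by (simp add: weight_def split: if_splits)
  qed
qed

section \<open>Relabellings induced by permutations of the coded universe\<close>

definition relabel :: "(nat \<Rightarrow> nat) \<Rightarrow> nat \<Rightarrow> nat" where
  "relabel \<sigma> v = (if even v then v else 2 * \<sigma> (v div 2) + 1)"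

lemma weight_relabel [simp]: "weight (relabel \<sigma> v) = weight v"
  by (simp add: weight_def relabel_def)

lemma relabel_relabel: "relabel \<sigma> (relabel \<rho> v) = relabel (\<sigma> \<circ> \<rho>) v"
  by (simp add: relabel_def)

lemma relabel_id: "(\<And>v. \<sigma> v = v) \<Longrightarrow> relabel \<sigma> v = v"
  by (simp add: relabel_def)

lemma relabel_address:
  assumes "R (l, xs) \<longleftrightarrow> S (l, map \<sigma> xs)"
  shows "relabel \<sigma> \<circ> address R (Inr (l, xs)) = address S (Inr (l, map \<sigma> xs))"
proof
  fix k
  show "(relabel \<sigma> \<circ> address R (Inr (l, xs))) k = address S (Inr (l, map \<sigma> xs)) k"
    using assms by (simp add: relabel_def split: nat.split)
qed

lemma weight_inject_even: "weight i = weight j \<Longrightarrow> even i \<Longrightarrow> i = j"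
  by (simp add: weight_def split: if_splits)

text \<open>Odd numbers have weight 2, and even ones have pairwise distinct weights at least 3. So
  \<open>\<tau>\<close> fixes the even numbers and permutes the odd ones, where it is read off as
  \<open>\<sigma>\<close>.\<close>

lemma weight_eq_imp_relabel:
  assumes "bij \<tau>" and w: "\<And>i. weight (\<tau> i) = weight i"
  obtains \<sigma> where "bij \<sigma>" "\<tau> = relabel \<sigma>"
proof -
  have even: "\<tau> i = i" if "even i" for i using weight_inject_even[OF w[symmetric] that] by simp
  have odd: "odd (\<tau> i)" if "odd i" for i
    using that w[of i] weight_inject_even[OF w, of i] by metis
  define \<sigma> where "\<sigma> v = \<tau> (2 * v + 1) div 2" for v
  have \<sigma>: "\<tau> (2 * v + 1) = 2 * \<sigma> v + 1" for v
    using odd[of "2 * v + 1"] by (simp add: \<sigma>_def)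
  have \<tau>: "\<tau> = relabel \<sigma>"
  proof
    fix i show "\<tau> i = relabel \<sigma> i"
      using even[of i] \<sigma>[of "i div 2"] by (cases "even i") (simp_all add: relabel_def)
  qed
  have "inj \<sigma>"
  proof (rule injI)
    fix v w assume "\<sigma> v = \<sigma> w"
    then have "\<tau> (2 * v + 1) = \<tau> (2 * w + 1)" by (simp only: \<sigma>)
    then have "2 * v + 1 = 2 * w + 1" using bij_is_inj[OF \<open>bij \<tau>\<close>] by (simp only: inj_eq)
    then show "v = w" by simp
  qed
  moreover have "surj \<sigma>"
    unfolding surj_def
  proof
    fix w
    obtain i where i: "\<tau> i = 2 * w + 1" using bij_is_surj[OF \<open>bij \<tau>\<close>] by (metis surjD)
    then have "odd i" using even[of i] by (cases "even i") auto
    then obtain v where "i = 2 * v + 1" by (rule oddE)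
    with i \<sigma>[of v] show "\<exists>v. w = \<sigma> v" by auto
  qed
  ultimately show ?thesis using that \<tau> by (simp add: bij_def)
qed

section \<open>Isomorphisms of the coded models versus relabellings of the coded predicates\<close>

context class_numbers
begin

lemma iso_coord_struct_if_relabelling:
  assumes \<sigma>: "bij \<sigma>" and R: "\<And>l xs. R (l, xs) \<longleftrightarrow> S (l, map \<sigma> xs)"
  shows "isomorphic L_E (coord_struct (pt (address R))) (coord_struct (pt (address S)))"
  unfolding isomorphic_coord_struct_iff
proof (rule bij_pt_of_relabelling[where \<tau> = "relabel \<sigma>"])
  \<comment> \<open>The action of \<open>\<sigma>\<close> on labels: it moves copies of constants
    and tuples of atoms. It stays within \<open>labels\<close> because \<open>relabel\<close>
    preserves weights.\<close>
  define \<beta> :: "(nat \<Rightarrow> nat) \<Rightarrow> label \<Rightarrow> label" where "\<beta> \<sigma> = map_sum (\<lambda>(i, k). (relabel \<sigma> i, k)) (\<lambda>(l, xs). (l, map \<sigma> xs))" for \<sigma>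
  have \<beta>_in: "\<beta> \<rho> \<iota> \<in> labels" if "\<iota> \<in> labels" for \<rho> \<iota>
    using that by (cases \<iota>) (auto simp: \<beta>_def)
  have \<beta>_inv: "\<beta> \<rho> (\<beta> \<pi> \<iota>) = \<iota>" if "\<And>v. \<rho> (\<pi> v) = v" for \<rho> \<pi> \<iota>
    using that by (cases \<iota>) (auto simp: \<beta>_def relabel_relabel relabel_id comp_def)
  have inv: "inv \<sigma> (\<sigma> v) = v" "\<sigma> (inv \<sigma> v) = v" for v
    using \<sigma> by (simp_all add: bij_is_inj bij_is_surj surj_f_inv_f)
  show "bij_betw (\<beta> \<sigma>) labels labels"
    by (rule bij_betw_byWitness[where f' = "\<beta> (inv \<sigma>)"]) (auto simp: \<beta>_in \<beta>_inv inv)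
  show "inj (relabel \<sigma>)"
    by (rule inj_on_inverseI[where g = "relabel (inv \<sigma>)"]) (simp add: relabel_relabel relabel_id inv)
  show "address S (\<beta> \<sigma> \<iota>) = relabel \<sigma> \<circ> address R \<iota>" for \<iota>
  proof (cases "(R, \<iota>)" rule: address.cases)
    case (1 R' i k)
    then show ?thesis by (auto simp: \<beta>_def)
  next
    case (2 R' l xs)
    then show ?thesis using relabel_address[of R l xs S \<sigma>, OF R] by (simp add: \<beta>_def del: address.simps)
  qed
  show "finite (range (address R \<iota>))" for \<iota> by (rule finite_range_address)
qed

lemma relabelling_if_iso_coord_struct:
  assumes "isomorphic L_E (coord_struct (pt (address R))) (coord_struct (pt (address S)))"
  shows "\<exists>\<sigma>. bij \<sigma> \<and> (\<forall>l xs. R (l, xs) \<longleftrightarrow> S (l, map \<sigma> xs))"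
proof -
  obtain g where g: "bij g"
      and pt: "\<And>n x y. pt (address R) x n = pt (address R) y n \<longleftrightarrow>
        pt (address S) (g x) n = pt (address S) (g y) n"
    using assms by (auto simp: isomorphic_coord_struct_iff)
  let ?a = "\<lambda>x. address R (label x)" and ?b = "\<lambda>x. address S (label (g x))"
  \<comment> \<open>Equality of sequences is eventual equality of points, which \<open>g\<close>
    preserves coordinate by coordinate.\<close>
  have eq_iff: "?a x = ?a y \<longleftrightarrow> ?b x = ?b y" for x y
    by (simp add: pt flip: MOST_pt_eq_iff)
  have card_eq: "card {\<iota> \<in> labels. address R \<iota> = ?a x} = card {\<iota> \<in> labels. address S \<iota> = ?b x}" for x
  proof -
    have "{y. pt (address S) y = pt (address S) (g x)} = g ` {y. pt (address R) y = pt (address R) x}"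
    proof (intro subset_antisym subsetI)
      fix z assume z: "z \<in> {y. pt (address S) y = pt (address S) (g x)}"
      obtain y where "z = g y" using bij_is_surj[OF g] by (metis surjD)
      with z show "z \<in> g ` {y. pt (address R) y = pt (address R) x}"
        by (auto simp: fun_eq_iff pt)
    qed (auto simp: fun_eq_iff pt)
    then have "card {y. pt (address S) y = pt (address S) (g x)} =
        card {y. pt (address R) y = pt (address R) x}"
      by (simp add: card_image inj_on_subset[OF bij_is_inj[OF g]])
    then show ?thesis unfolding card_pt_eq by simp
  qed
  have "\<exists>x. ?a x = (\<lambda>_. i)" for i
  proof -
    have "Inl (i, 0) \<in> labels" by (simp add: weight_def)
    then obtain x where "label x = Inl (i, 0)" by (rule surj_label)
    then have "?a x = (\<lambda>_. i)" by simp
    then show ?thesis ..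
  qed
  then have "\<forall>i. \<exists>x. ?a x = (\<lambda>_. i)" by blast
  \<comment> \<open>\<open>pick i\<close> is an element whose sequence is constantly
    \<open>i\<close>; the images of these elements define \<open>\<tau>\<close>.\<close>
  from choice[OF this] obtain pick where "\<forall>i. ?a (pick i) = (\<lambda>_. i)" ..
  then have pick: "?a (pick i) = (\<lambda>_. i)" for i ..
  have "\<exists>j. ?b (pick i) = (\<lambda>_. j) \<and> weight j = weight i" for i
    using card_eq[of "pick i"] pick by (intro address_const_transfer)
  then have "\<forall>i. \<exists>j. ?b (pick i) = (\<lambda>_. j) \<and> weight j = weight i" by blast
  from choice[OF this] obtain \<tau>
    where *: "\<forall>i. ?b (pick i) = (\<lambda>_. \<tau> i) \<and> weight (\<tau> i) = weight i" ..
  then have \<tau>: "?b (pick i) = (\<lambda>_. \<tau> i)" and w: "weight (\<tau> i) = weight i" for i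
    by simp_all
  have const: "i = j" if "(\<lambda>_ :: nat. i :: nat) = (\<lambda>_. j)" for i j
    using fun_cong[OF that] .
  have "inj \<tau>"
  proof (rule injI)
    fix i j assume "\<tau> i = \<tau> j"
    then have "?a (pick i) = ?a (pick j)" unfolding eq_iff \<tau> by simp
    then show "i = j" unfolding pick by (rule const)
  qed
  moreover have "surj \<tau>"
    unfolding surj_def
  proof
    fix j
    have "Inl (j, 0) \<in> labels" by (simp add: weight_def)
    then obtain y where "label y = Inl (j, 0)" by (rule surj_label)
    moreover obtain x where "y = g x" using bij_is_surj[OF g] by (rule surjE)
    ultimately have j: "?b x = (\<lambda>_. j)" by simp
    \<comment> \<open>Recognition of constants by multiplicity works in the backward direction too,
      so a constant sequence in the target comes from a constant one.\<close>
    then obtain i where "?a x = (\<lambda>_. i)"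
      using address_const_transfer[OF card_eq[of x, symmetric]] by blast
    then have "?b x = ?b (pick i)" by (simp only: pick flip: eq_iff)
    then have "j = \<tau> i" unfolding j \<tau> by (rule const)
    then show "\<exists>i. j = \<tau> i" ..
  qed
  ultimately have "bij \<tau>" by (rule bijI)
  then obtain \<sigma> where \<sigma>: "bij \<sigma>" "\<tau> = relabel \<sigma>"
    using w by (rule weight_eq_imp_relabel)
  have b: "?b x = \<tau> \<circ> ?a x" for x
  proof
    fix k
    \<comment> \<open>At almost all coordinates with slot \<open>k\<close>, the point of
      \<open>x\<close> agrees with that of this constant sequence. The map \<open>g\<close> keeps
      the agreement, and the image of the constant one has the value
      \<open>\<tau> (?a x k)\<close>.\<close>
    let ?y = "pick (?a x k)"
    have "\<forall>\<^sub>\<infinity>n. slot n = k \<longrightarrow> pt (address R) x n = pt (address R) ?y n"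
      using MOST_pt[of "address R" x] MOST_pt[of "address R" ?y]
        MOST_center[of k "?a x"] MOST_center[of k "?a ?y"]
    proof eventually_elim
      case (elim n)
      then show ?case using fun_cong[OF pick[of "?a x k"], of k] by simp
    qed
    then have "\<forall>\<^sub>\<infinity>n. slot n = k \<longrightarrow> ?b x k = ?b ?y k"
      using MOST_pt[of "address S" "g x"] MOST_pt[of "address S" "g ?y"]
        MOST_center[of k "?b x"] MOST_center[of k "?b ?y"]
    proof eventually_elim
      case (elim n)
      then show ?case unfolding pt by simp
    qed
    with INFM_slot[of k] have "\<exists>\<^sub>\<infinity>n :: nat. ?b x k = ?b ?y k" by (rule frequently_rev_mp)
    then show "?b x k = (\<tau> \<circ> ?a x) k" by (simp add: \<tau>)
  qed
  have "R (l, xs) \<longleftrightarrow> S (l, map \<sigma> xs)" for l xs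
  proof -
    have "(Inr (l, xs) :: label) \<in> labels" by simp
    then obtain x where x: "label x = Inr (l, xs)" by (rule surj_label)
    \<comment> \<open>The truth value on the right is still that of \<open>R\<close>: a constant
      predicate stands in until the label of \<open>g x\<close> is known. Injectivity of the coding
      then compares it with \<open>S\<close>.\<close>
    have *: "?b x = address (\<lambda>_. R (l, xs)) (Inr (l, map \<sigma> xs))"
      unfolding b x \<sigma>(2) by (rule relabel_address) simp
    show ?thesis
    proof (cases "label (g x)")
      case (Inl p)
      with * have "address (\<lambda>_. R (l, xs)) (Inr (l, map \<sigma> xs)) = (\<lambda>_. fst p)"
        by (cases p) simp
      with address_Inr_neq_const show ?thesis by blast
    next
      case (Inr a)
      with * show ?thesis by (simp only: address_Inr_inject) blast
    qed
  qed
  with \<sigma>(1) show ?thesis by blast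
qed

lemma relabelling_iff_iso_coord_struct:
  "isomorphic L_E (coord_struct (pt (address R))) (coord_struct (pt (address S))) \<longleftrightarrow>
     (\<exists>\<sigma>. bij \<sigma> \<and> (\<forall>l xs. R (l, xs) \<longleftrightarrow> S (l, map \<sigma> xs)))"
proof
  assume "\<exists>\<sigma>. bij \<sigma> \<and> (\<forall>l xs. R (l, xs) \<longleftrightarrow> S (l, map \<sigma> xs))"
  then obtain \<sigma> where "bij \<sigma>" "\<forall>l xs. R (l, xs) \<longleftrightarrow> S (l, map \<sigma> xs)" by blast
  then show "isomorphic L_E (coord_struct (pt (address R))) (coord_struct (pt (address S)))"
    by (intro iso_coord_struct_if_relabelling) simp_all
qed (rule relabelling_if_iso_coord_struct)

section \<open>The Borel reduction\<close>

lemma measurable_pt_address_truth: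
  "(\<lambda>M. pt (address (truth L M)) x n) \<in> Str L \<rightarrow>\<^sub>M count_space UNIV"
proof (cases "label x")
  case (Inl p)
  then show ?thesis by (cases p) (simp add: pt_def)
next
  case (Inr a)
  \<comment> \<open>The label of \<open>x\<close> does not depend on \<open>M\<close>, so the point
    depends on \<open>M\<close> only through the truth value of one atom.\<close>
  have "pt (address (truth L M)) x n = pt (address (\<lambda>_. truth L M a)) x n" for M
  proof -
    have "address (truth L M) (label x) = address (\<lambda>_. truth L M a) (label x)"
      unfolding Inr address_Inr_inject by simp
    then show ?thesis by (simp add: pt_def)
  qed
  moreover have "(\<lambda>M. pt (address (\<lambda>_. truth L M a)) x n) \<in> Str L \<rightarrow>\<^sub>M count_space UNIV"
    by (rule measurable_compose[OF measurable_truth]) simp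
  ultimately show ?thesis by simp
qed

lemma borel_complete_theory_T_h: "borel_complete_theory L_E (T_h h)"
  unfolding borel_complete_theory_def borel_complete_def
proof (intro conjI allI impI)
  show "is_theory L_E (T_h h)" by (rule is_theory_T_h)
  then show "invariant_borel_class L_E (Mod L_E (T_h h))"
    using countable_T_h by (rule invariant_borel_class_Mod)
  fix L K assume "invariant_borel_class L K"
  let ?f = "\<lambda>M. coord_struct (pt (address (truth L M)))"
  have "?f M \<in> Mod L_E (T_h h)" for M
    by (intro coord_struct_in_Mod nonzero pt_less pt_dense)
  moreover have "?f \<in> restrict_space (Str L) K \<rightarrow>\<^sub>M Str L_E"
    by (intro measurable_restrict_space1 measurable_coord_struct measurable_pt_address_truth)
  ultimately have f: "?f \<in> restrict_space (Str L) K \<rightarrow>\<^sub>M restrict_space (Str L_E) (Mod L_E (T_h h))"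
    by (intro measurable_restrict_space2) auto
  show "borel_reducible L K L_E (Mod L_E (T_h h))"
    unfolding borel_reducible_def
  proof (intro bexI[OF _ f] ballI)
    fix M N
    show "isomorphic L M N \<longleftrightarrow> isomorphic L_E (?f M) (?f N)"
      unfolding relabelling_iff_iso_coord_struct isomorphic_def[of L] iso_via_iff_truth[of L] ..
  qed
qed

end

theorem theorem2p1:
  fixes h :: "nat \<Rightarrow> nat"
  assumes "strict_mono h" and "\<And>n. h n \<noteq> 0"
  shows "borel_complete_theory L_E (T_h h)"
proof -
  interpret class_numbers h using assms by unfold_locales
  show ?thesis by (rule borel_complete_theory_T_h)
qed

end
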